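(* There exist absolute constants $C_{\mathrm{SNR}} > 0$ and $C_d > 0$ with $C_d < C_{\mathrm{SNR}}$ such that the following holds. Let $\{X_1, X_2, \ldots\}$ be a sequence of independent real random variables with means $\mathbb{E}(X_i) = f_i$ and $\sup_{i \ge 1} \|X_i\|_{\psi_2} \le \sigma$. Let $\alpha \in (0,1)$ and let $\widehat{t}$ be the stopping time $$\widehat{t} = \inf\Big\{t \ge 2 : \ \exists\, s \in \{1, \ldots, t-1\} \text{ with } \widehat{D}_{s,t} > b_t \Big\}, \qquad b_t = 2^{3/2}\sigma \log^{1/2}(t/\alpha),$$ where $\widehat{D}_{s,t}$ is the CUSUM statistic. (i) If $\Delta = \infty$ (all the means $f_i$ are equal), then $\mathbb{P}_\infty\{\widehat{t} < \infty\} < \alpha$. (ii) If there is a positive integer $\Delta \ge 1$ with $f_1 = \cdots = f_\Delta \ne f_{\Delta+1} = f_{\Delta+2} = \cdots$, then $\mathbb{P}_\Delta\{\widehat{t} \le \Delta\} < \alpha$, for any $\Delta \ge 1$. (iii) If the means are as in (ii), $\kappa = |f_\Delta - f_{\Delta+1}|$, and in addition $$\Delta \kappa^2 \sigma^{-2} \ge C_{\mathrm{SNR}} \log(\Delta/\alpha),$$ then $$\mathbb{P}_\Delta\left\{\Delta < \widehat{t} \le \Delta + C_d \frac{\sigma^2 \log(\Delta/\alpha)}{\kappa^2}\right\} \ge 1 - \alpha.$$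
   Context: The Orlicz norm is $\|X\|_{\psi_2} = \inf\{t > 0 : \mathbb{E}\{\exp(X^2/t^2)\} \le 2\}$. For integers $1 \le s < t$ the CUSUM statistic is $$\widehat{D}_{s,t} = \left| \left(\frac{t-s}{ts}\right)^{1/2} \sum_{l=1}^s X_l - \left\{\frac{s}{t(t-s)}\right\}^{1/2} \sum_{l=s+1}^t X_l \right|.$$ The stopping time $\widehat{t}$ takes values in $\mathbb{N} \cup \{\infty\}$, with $\inf \emptyset = \infty$. $\mathbb{P}_\Delta$ denotes probability under any distribution of the sequence satisfying the stated assumptions with change point after time $\Delta$, and $\mathbb{P}_\infty$ denotes probability under any such distribution with constant means. "Absolute constant" means a number not depending on $\Delta, \kappa, \sigma, \alpha$ or the distributions of the data.
   Formalization: Part (iii) is stated for Δ ≥ 2 only: for Δ = 1 the SNR condition and C_d < C_SNR make the detection window (Δ, Δ + C_d σ² log(Δ/α)/κ²] free of integers, so the claim fails there. The variables live on a sample space of real sequences, which realizes every law. *)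

theory Defs
  imports "HOL-Probability.Probability"
begin

(* Sample space of the probability spaces in the theorem. The absolute constants are chosen before
   the probability space, and HOL cannot quantify over types below an existential quantifier, so
   a polymorphic sample space would let the constants depend on the type. The type of real
   sequences loses no generality: every sequence of real random variables, on any probability
   space, has the same law as the coordinate sequence on a probability space over this type. The
   measure, its sigma-algebra and the random variables remain arbitrary. *)
type_synonym sample = "nat \<Rightarrow> real"

(* Extended-real valued with a nonnegative integral for the expectation: the norm is infinite
   (Inf of the empty set) when no t is admissible, and a divergent expectation is not mistaken
   for 0. *)
definition psi2_norm :: "'a measure \<Rightarrow> ('a \<Rightarrow> real) \<Rightarrow> ereal" where
  "psi2_norm M Y =
     Inf (ereal ` {t. 0 < t \<and> (\<integral>\<^sup>+\<omega>. ennreal (exp ((Y \<omega>)\<^sup>2 / t\<^sup>2)) \<partial>M) \<le> 2})"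

definition cusum :: "(nat \<Rightarrow> 'a \<Rightarrow> real) \<Rightarrow> nat \<Rightarrow> nat \<Rightarrow> 'a \<Rightarrow> real" where
  "cusum X s t \<omega> =
     \<bar>sqrt ((real t - real s) / (real t * real s)) * (\<Sum>l=1..s. X l \<omega>)
      - sqrt (real s / (real t * (real t - real s))) * (\<Sum>l=s+1..t. X l \<omega>)\<bar>"

definition threshold :: "real \<Rightarrow> real \<Rightarrow> nat \<Rightarrow> real" where
  "threshold \<sigma> \<alpha> t = 2 powr (3/2) * \<sigma> * sqrt (ln (real t / \<alpha>))"

(* In enat the infimum of the empty set is infinity. *)
definition stop_time :: "real \<Rightarrow> real \<Rightarrow> (nat \<Rightarrow> 'a \<Rightarrow> real) \<Rightarrow> 'a \<Rightarrow> enat" where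
  "stop_time \<sigma> \<alpha> X \<omega> =
     Inf (enat ` {t. 2 \<le> t \<and> (\<exists>s\<in>{1..t-1}. cusum X s t \<omega> > threshold \<sigma> \<alpha> t)})"

(* Sequences are indexed from 1; the value at index 0 is never used. *)
definition constant_means :: "(nat \<Rightarrow> real) \<Rightarrow> bool" where
  "constant_means f \<longleftrightarrow> (\<forall>i\<ge>1. f i = f 1)"

definition change_point :: "(nat \<Rightarrow> real) \<Rightarrow> nat \<Rightarrow> bool" where
  "change_point f \<Delta> \<longleftrightarrow>
     1 \<le> \<Delta> \<and> (\<forall>i\<in>{1..\<Delta>}. f i = f 1) \<and> f \<Delta> \<noteq> f (\<Delta> + 1) \<and> (\<forall>i\<ge>\<Delta>+1. f i = f (\<Delta> + 1))"

end

(* All parts hold on one event: every CUSUM statistic of the centred data stays below its threshold.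
   The heart of the matter is that the constant in the threshold is just large enough for a union
   bound over all pairs s < t. If E exp(Y^2) \<le> 2, then E exp(c (Y - E Y)) \<le> exp(2 c^2 / 3)
   for every c. By Chernoff's bound each centred CUSUM statistic then exceeds its threshold with
   probability at most 2 (\<alpha>/t)^3, and since (t - 1)/t^3 \<le> 1/(t (t + 1)), these bounds sum
   to at most \<alpha>^3 < \<alpha>. Off the exceptional event there is no alarm up to the change point,
   where the centred and the raw statistics coincide, and an alarm is raised as soon as the drift
   of the statistic that splits at the change point is more than twice the threshold. *)

theory Submission
  imports Defs
begin

section \<open>Elementary inequalities for the exponential function\<close>

text \<open>Serves \<open>mgf_centered_2\<close>: after integration the right side becomes affine in
  the mean, so that centring costs only a factor. The margin is small, hence the case split: Taylor
  on the left, chords of \<open>exp\<close> for moderate \<open>x\<close>, and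
  \<open>2 * x \<le> x\<^sup>2\<close> from 2 on.\<close>

lemma exp_2_mult_le:
  fixes x :: real
  shows "exp (2 * x) \<le> 4 * x + 2 * exp (x\<^sup>2)"
proof -
  consider "x \<le> 0" | "0 \<le> x" "x \<le> 1/2" | "1/2 \<le> x" "x \<le> 3/2" | "3/2 \<le> x" "x \<le> 2" | "2 \<le> x"
    by linarith
  then show ?thesis
  proof cases
    case 1
    obtain t where t: "\<bar>t\<bar> \<le> \<bar>2 * x\<bar>"
      "exp (2 * x) = (\<Sum>m<5. ((2 * x) ^ m) / fact m) + (exp t / fact 5) * (2 * x) ^ 5"
      using Maclaurin_exp_le[of "2 * x" 5] by blast
    have "(2 * x) ^ 5 \<le> 0"
      using 1 by (simp add: power_le_zero_eq)
    then have "(exp t / fact 5) * (2 * x) ^ 5 \<le> 0"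
      by (intro mult_nonneg_nonpos) auto
    then have up: "exp (2 * x) \<le> 1 + 2 * x + 2 * x\<^sup>2 + 4/3 * x ^ 3 + 2/3 * x ^ 4"
      using t(2) by (simp add: eval_nat_numeral algebra_simps)
    have lo: "1 + x\<^sup>2 + x ^ 4 / 2 \<le> exp (x\<^sup>2)"
      using exp_lower_Taylor_quadratic[of "x\<^sup>2"] by simp
    \<comment> \<open>71/100 approximates 1 / sqrt 2; the cubic 1 + 2 x - 4/3 x^3 has its minimum over x \<le> 0 at - 1 / sqrt 2\<close>
    have "0 \<le> (x + 71/100)\<^sup>2 * (142/100 - x)"
      using 1 by simp
    also have "\<dots> = 357911/500000 + 15123/10000 * x - x ^ 3"
      by (simp add: field_simps power2_eq_square power3_eq_cube)
    finally have "0 \<le> 1 + 2 * x - 4/3 * x ^ 3"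
      using 1 by argo
    moreover have "0 \<le> x ^ 4" by simp
    ultimately show ?thesis using up lo by argo
  next
    case 2
    have "exp (2 * x) \<le> (1 - 2 * x) + (2 * x) * exp (1::real)"
      using convex_onD[OF exp_convex, of "2 * x" 0 "1::real"] 2 by simp
    moreover have "exp (1::real) \<le> 3" by (rule exp_le)
    then have "(2 * x) * exp (1::real) \<le> (2 * x) * 3"
      using 2 by (intro mult_left_mono) auto
    moreover have "1 \<le> exp (x\<^sup>2)" by simp
    ultimately show ?thesis using 2 by argo
  next
    case 3
    have e: "exp (1::real) \<le> 272/100" using e_less_272 by simp
    have "exp (3::real) = exp 1 ^ 3" by (simp flip: exp_of_nat_mult)
    also have "\<dots> \<le> (272/100) ^ 3" using e by (intro power_mono) auto
    finally have e3: "exp (3::real) \<le> 2013/100" by (simp add: power3_eq_cube)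
    have "exp (2 * x) \<le> (1 - 2/3 * x) + (2/3 * x) * exp (3::real)"
      using convex_onD[OF exp_convex, of "2/3 * x" 0 "3::real"] 3 by (simp add: algebra_simps)
    moreover have "(2/3 * x) * exp (3::real) \<le> (2/3 * x) * (2013/100)"
      using 3 e3 by (intro mult_left_mono) auto
    ultimately have u: "exp (2 * x) \<le> 1 + 1276/100 * x"
      using 3 by argo
    \<comment> \<open>This shows that \<open>2 * exp (x\<^sup>2)\<close> covers at least the
      fraction 200/272 of \<open>exp (2 * x)\<close>; by the chord bound \<open>u\<close> the
      remaining 72/272 stays below \<open>4 * x\<close> once \<open>1/2 \<le> x\<close>.\<close>
    have "0 \<le> (x - 1)\<^sup>2" by simp
    then have "exp (2 * x) \<le> exp (x\<^sup>2 + 1)"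
      by (simp add: power2_eq_square algebra_simps)
    also have "\<dots> = exp (x\<^sup>2) * exp 1" by (simp add: exp_add)
    also have "\<dots> \<le> exp (x\<^sup>2) * (272/100)" using e by (intro mult_left_mono) auto
    finally show ?thesis using u 3 by (simp add: field_simps)
  next
    case 4
    have e: "exp (1::real) \<le> 272/100" using e_less_272 by simp
    have "exp (2 * x) \<le> exp 4" using 4 by simp
    also have "exp (4::real) = exp 1 ^ 4" by (simp flip: exp_of_nat_mult)
    also have "\<dots> \<le> (272/100) ^ 4" using e by (intro power_mono) auto
    finally have e4: "exp (2 * x) \<le> 55" by (simp add: power4_eq_xxxx)
    \<comment> \<open>At distance 1/2 from the tangency point 1 a factor \<open>exp (1/4)\<close>,
      at least 5/4, is gained. The uncovered fraction of \<open>exp (2 * x)\<close> is then 22/272,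
      and with the bound 55 it stays below \<open>4 * x\<close>.\<close>
    have "(1/2)\<^sup>2 \<le> (x - 1)\<^sup>2" using 4 by (intro power_mono) auto
    then have "exp (2 * x + 1/4) \<le> exp (x\<^sup>2 + 1)"
      by (simp add: power2_eq_square algebra_simps)
    then have "exp (2 * x) * exp (1/4) \<le> exp (x\<^sup>2) * exp 1" by (simp add: exp_add)
    also have "\<dots> \<le> exp (x\<^sup>2) * (272/100)" using e by (intro mult_left_mono) auto
    finally have "exp (2 * x) * exp (1/4) \<le> exp (x\<^sup>2) * (272/100)" .
    moreover have "exp (2 * x) * (5/4) \<le> exp (2 * x) * exp (1/4)"
      using exp_ge_add_one_self[of "1/4::real"] by (intro mult_left_mono) auto
    ultimately show ?thesis using e4 4 by argo
  next
    case 5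
    then have "2 * x \<le> x\<^sup>2" by (simp add: power2_eq_square)
    then have "exp (2 * x) \<le> exp (x\<^sup>2)" by simp
    moreover have "0 < exp (x\<^sup>2)" by simp
    ultimately show ?thesis using 5 by linarith
  qed
qed

text \<open>A sharper form of the familiar bound with \<open>exp (y\<^sup>2)\<close>. The factor 2/3
  is what later gives the cube in \<open>noise_tail\<close>.\<close>

lemma exp_le_add_exp_square:
  fixes y :: real
  shows "exp y \<le> y + exp (2/3 * y\<^sup>2)"
proof -
  consider "y \<le> 0" | "0 \<le> y" "y \<le> 1" | "1 \<le> y" "y \<le> 3/2" | "3/2 \<le> y"
    by linarith
  then show ?thesis
  proof cases
    case 1
    obtain t where t: "\<bar>t\<bar> \<le> \<bar>y\<bar>"
      "exp y = (\<Sum>m<3. (y ^ m) / fact m) + (exp t / fact 3) * y ^ 3"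
      using Maclaurin_exp_le[of y 3] by blast
    have "y ^ 3 \<le> 0"
      using 1 by (simp add: power_le_zero_eq)
    then have "(exp t / fact 3) * y ^ 3 \<le> 0"
      by (intro mult_nonneg_nonpos) auto
    then have "exp y \<le> 1 + y + y\<^sup>2 / 2"
      using t(2) by (simp add: eval_nat_numeral algebra_simps)
    moreover have "1 + 2/3 * y\<^sup>2 \<le> exp (2/3 * y\<^sup>2)" by (rule exp_ge_add_one_self)
    moreover have "0 \<le> y\<^sup>2" by simp
    ultimately show ?thesis by argo
  next
    case 2
    obtain t where t: "\<bar>t\<bar> \<le> \<bar>y\<bar>"
      "exp y = (\<Sum>m<4. (y ^ m) / fact m) + (exp t / fact 4) * y ^ 4"
      using Maclaurin_exp_le[of y 4] by blast
    have "exp t \<le> exp 1" using t(1) 2 by simp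
    also have "\<dots> \<le> 3" by (rule exp_le)
    finally have "(exp t / fact 4) * y ^ 4 \<le> (3 / fact 4) * y ^ 4"
      by (intro mult_right_mono divide_right_mono) auto
    then have "exp y \<le> 1 + y + y\<^sup>2 / 2 + y ^ 3 / 6 + y ^ 4 / 8"
      using t(2) by (simp add: eval_nat_numeral algebra_simps)
    moreover have "1 + 2/3 * y\<^sup>2 + 2/9 * y ^ 4 \<le> exp (2/3 * y\<^sup>2)"
      using exp_lower_Taylor_quadratic[of "2/3 * y\<^sup>2"] by (simp add: power_mult_distrib power_divide)
    moreover have "y ^ 3 \<le> y\<^sup>2" using 2 by (simp add: power_decreasing)
    moreover have "0 \<le> y ^ 4" by simp
    ultimately show ?thesis using 2 by argo
  next
    case 3
    have "exp y \<le> (3 - 2 * y) * exp 1 + (2 * y - 2) * exp (3/2::real)"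
      using convex_onD[OF exp_convex, of "2 * y - 2" 1 "3/2::real"] 3
      by (simp add: algebra_simps)
    moreover have "(3 - 2 * y) * exp (1::real) \<le> (3 - 2 * y) * (272/100)"
      using 3 e_less_272 by (intro mult_left_mono) auto
    moreover have "exp (3/2::real) \<le> 45/10"
    proof (rule power2_le_imp_le)
      have "(exp (3/2::real))\<^sup>2 = exp 1 ^ 3" by (simp flip: exp_of_nat_mult)
      also have "\<dots> \<le> (272/100) ^ 3" using e_less_272 by (intro power_mono) auto
      finally show "(exp (3/2::real))\<^sup>2 \<le> (45/10)\<^sup>2" by (simp add: power2_eq_square power3_eq_cube)
    qed simp
    then have "(2 * y - 2) * exp (3/2::real) \<le> (2 * y - 2) * (45/10)"
      using 3 by (intro mult_left_mono) auto
    ultimately have "exp y \<le> (3 - 2 * y) * (272/100) + (2 * y - 2) * (45/10)"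
      by linarith
    moreover have "1 + 2/3 * y\<^sup>2 + 2/9 * y ^ 4 \<le> exp (2/3 * y\<^sup>2)"
      using exp_lower_Taylor_quadratic[of "2/3 * y\<^sup>2"] by (simp add: power_mult_distrib power_divide)
    \<comment> \<open>Tangent at \<open>y = 6/5\<close>, followed by the tangent of the squaring map
      at \<open>y\<^sup>2 = 36/25\<close>: they make the lower Taylor bound linear in
      \<open>y\<close>, so that comparing it with the chord over [1, 3/2] is linear
      arithmetic.\<close>
    moreover have "2 * (6/5) * y - 36/25 \<le> y\<^sup>2"
      using zero_le_power2[of "y - 6/5"] by (simp add: power2_eq_square algebra_simps)
    moreover have "2 * (36/25) * y\<^sup>2 - 1296/625 \<le> y ^ 4"
      using zero_le_power2[of "y\<^sup>2 - 36/25"] by (simp add: power2_eq_square power4_eq_xxxx algebra_simps)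
    ultimately show ?thesis using 3 by (argo)
  next
    case 4
    then have "y \<le> 2/3 * y\<^sup>2" by (simp add: power2_eq_square)
    then have "exp y \<le> exp (2/3 * y\<^sup>2)" by simp
    then show ?thesis using 4 by linarith
  qed
qed

text \<open>The chord of \<open>exp\<close> from 0 to \<open>z\<close>. It lowers the exponent of
  \<open>exp (y\<^sup>2)\<close>, so that the excess of the expectation over 1 shrinks by the factor
  \<open>q\<close>.\<close>

lemma exp_mult_le_Bernoulli:
  fixes q z :: real
  assumes "0 \<le> q" "q \<le> 1"
  shows "exp (q * z) \<le> 1 + q * (exp z - 1)"
  using convex_onD[OF exp_convex, of q 0 z] assms by (simp add: algebra_simps)

text \<open>Log-convexity of the moment generating function. In place of Hoelder's inequality,
  convexity of \<open>exp\<close> is applied pointwise to \<open>a * Z - p\<close> and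
  \<open>b * Z - q\<close>, whose exponentials have expectation at most 1.\<close>

lemma (in prob_space) mgf_interpolate:
  fixes Z :: "'a \<Rightarrow> real"
  assumes int: "integrable M (\<lambda>\<omega>. exp (a * Z \<omega>))" "integrable M (\<lambda>\<omega>. exp (b * Z \<omega>))"
    "integrable M (\<lambda>\<omega>. exp (((1 - \<theta>) * a + \<theta> * b) * Z \<omega>))"
    and le: "expectation (\<lambda>\<omega>. exp (a * Z \<omega>)) \<le> exp p" "expectation (\<lambda>\<omega>. exp (b * Z \<omega>)) \<le> exp q"
    and \<theta>: "0 \<le> \<theta>" "\<theta> \<le> 1"
  shows "expectation (\<lambda>\<omega>. exp (((1 - \<theta>) * a + \<theta> * b) * Z \<omega>)) \<le> exp ((1 - \<theta>) * p + \<theta> * q)"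
proof -
  let ?r = "(1 - \<theta>) * p + \<theta> * q"
  have pw: "exp (((1 - \<theta>) * a + \<theta> * b) * z) \<le>
      exp ?r * ((1 - \<theta>) * (exp (a * z) * exp (- p)) + \<theta> * (exp (b * z) * exp (- q)))" for z
  proof -
    have "exp ((1 - \<theta>) * (a * z - p) + \<theta> * (b * z - q)) \<le>
        (1 - \<theta>) * exp (a * z - p) + \<theta> * exp (b * z - q)"
      using convex_onD[OF exp_convex, of \<theta> "a * z - p" "b * z - q"] \<theta> by simp
    then have "exp ?r * exp ((1 - \<theta>) * (a * z - p) + \<theta> * (b * z - q)) \<le>
        exp ?r * ((1 - \<theta>) * exp (a * z - p) + \<theta> * exp (b * z - q))"
      by (intro mult_left_mono) auto
    then show ?thesis
      by (simp add: exp_add[symmetric] algebra_simps)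
  qed
  have "expectation (\<lambda>\<omega>. exp (((1 - \<theta>) * a + \<theta> * b) * Z \<omega>)) \<le>
      expectation (\<lambda>\<omega>. exp ?r * ((1 - \<theta>) * (exp (a * Z \<omega>) * exp (- p)) + \<theta> * (exp (b * Z \<omega>) * exp (- q))))"
    using int by (intro integral_mono pw) auto
  also have "\<dots> = exp ?r * ((1 - \<theta>) * (expectation (\<lambda>\<omega>. exp (a * Z \<omega>)) * exp (- p))
      + \<theta> * (expectation (\<lambda>\<omega>. exp (b * Z \<omega>)) * exp (- q)))"
    using int by simp
  also have "\<dots> \<le> exp ?r * ((1 - \<theta>) * (exp p * exp (- p)) + \<theta> * (exp q * exp (- q)))"
    using le \<theta> by (intro mult_left_mono add_mono mult_right_mono) auto
  also have "\<dots> = exp ?r"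
    by (simp flip: exp_add)
  finally show ?thesis .
qed

section \<open>Moment generating functions on the psi2 unit ball\<close>

text \<open>The scale 1 is admissible in \<open>psi2_norm\<close>; other scales are reduced to this
  one by division in \<open>psi2_ball_scale\<close>.\<close>

locale psi2_unit_ball = prob_space M for M :: "'a measure" +
  fixes Y :: "'a \<Rightarrow> real"
  assumes Y_measurable [measurable]: "Y \<in> borel_measurable M"
    and nn_integral_exp_square_le: "(\<integral>\<^sup>+\<omega>. ennreal (exp ((Y \<omega>)\<^sup>2)) \<partial>M) \<le> 2"
begin

lemma uminus_psi2_unit_ball: "psi2_unit_ball M (\<lambda>\<omega>. - Y \<omega>)"
  by unfold_locales (use nn_integral_exp_square_le in auto)

lemma integrable_exp_square: "integrable M (\<lambda>\<omega>. exp ((Y \<omega>)\<^sup>2))"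
  using nn_integral_exp_square_le
  by (intro integrableI_nonneg) (auto simp: less_top[symmetric] top_unique)

lemma expectation_exp_square_le: "expectation (\<lambda>\<omega>. exp ((Y \<omega>)\<^sup>2)) \<le> 2"
proof -
  have "ennreal (expectation (\<lambda>\<omega>. exp ((Y \<omega>)\<^sup>2))) \<le> ennreal 2"
    using nn_integral_exp_square_le
    by (subst nn_integral_eq_integral[symmetric, OF integrable_exp_square]) auto
  then show ?thesis by (subst (asm) ennreal_le_iff) auto
qed

lemma integrable_square: "integrable M (\<lambda>\<omega>. (Y \<omega>)\<^sup>2)"
proof (rule Bochner_Integration.integrable_bound[OF integrable_exp_square])
  show "AE \<omega> in M. norm ((Y \<omega>)\<^sup>2) \<le> norm (exp ((Y \<omega>)\<^sup>2))"
    using exp_ge_add_one_self by (auto intro!: AE_I2 order_trans[OF _ exp_ge_add_one_self])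
qed auto

lemma expectation_square_le: "expectation (\<lambda>\<omega>. (Y \<omega>)\<^sup>2) \<le> 1"
proof -
  have "expectation (\<lambda>\<omega>. 1 + (Y \<omega>)\<^sup>2) \<le> expectation (\<lambda>\<omega>. exp ((Y \<omega>)\<^sup>2))"
    using integrable_square integrable_exp_square
    by (intro integral_mono exp_ge_add_one_self) auto
  then show ?thesis
    using expectation_exp_square_le integrable_square by (simp add: prob_space)
qed

lemma integrable_exp_mult: "integrable M (\<lambda>\<omega>. exp (c * Y \<omega>))"
proof (rule Bochner_Integration.integrable_bound)
  show "integrable M (\<lambda>\<omega>. exp (c\<^sup>2 / 4) * exp ((Y \<omega>)\<^sup>2))"
    using integrable_exp_square by simp
  have "c * y \<le> c\<^sup>2 / 4 + y\<^sup>2" for y :: real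
    using zero_le_power2[of "c / 2 - y"] by (simp add: power2_eq_square algebra_simps)
  then show "AE \<omega> in M. norm (exp (c * Y \<omega>)) \<le> norm (exp (c\<^sup>2 / 4) * exp ((Y \<omega>)\<^sup>2))"
    by (auto simp flip: exp_add)
qed auto

lemma integrable: "integrable M Y"
proof (rule Bochner_Integration.integrable_bound)
  show "integrable M (\<lambda>\<omega>. 1 + (Y \<omega>)\<^sup>2)"
    using integrable_square by simp
  have "\<bar>y\<bar> \<le> 1 + y\<^sup>2" for y :: real
    using zero_le_power2[of "\<bar>y\<bar> - 1"] by (simp add: power2_diff)
  then show "AE \<omega> in M. norm (Y \<omega>) \<le> norm (1 + (Y \<omega>)\<^sup>2)"
    by (auto intro!: AE_I2 order_trans[OF _ abs_ge_self])
qed auto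

text \<open>The arithmetic-geometric mean inequality reduces the mean to the second moment, which is
  at most 1 because \<open>1 + y\<^sup>2 \<le> exp (y\<^sup>2)\<close>.\<close>

lemma expectation_le_1: "expectation Y \<le> 1"
proof -
  have "y \<le> (1 + y\<^sup>2) / 2" for y :: real
    using zero_le_power2[of "y - 1"] by (simp add: power2_diff)
  then have "expectation Y \<le> expectation (\<lambda>\<omega>. (1 + (Y \<omega>)\<^sup>2) / 2)"
    using integrable integrable_square by (intro integral_mono) auto
  also have "\<dots> \<le> 1"
    using expectation_square_le integrable_square by (simp add: prob_space)
  finally show ?thesis .
qed

lemma abs_expectation_le_1: "\<bar>expectation Y\<bar> \<le> 1"
proof -
  interpret neg: psi2_unit_ball M "\<lambda>\<omega>. - Y \<omega>" by (rule uminus_psi2_unit_ball)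
  show ?thesis using expectation_le_1 neg.expectation_le_1 by simp
qed

lemma integrable_exp_centered: "integrable M (\<lambda>\<omega>. exp (c * (Y \<omega> - m)))"
  using integrable_mult_left[OF integrable_exp_mult[of c], of "exp (- c * m)"]
  by (simp add: algebra_simps flip: exp_add)

lemma expectation_exp_centered:
  "expectation (\<lambda>\<omega>. exp (c * (Y \<omega> - m))) = expectation (\<lambda>\<omega>. exp (c * Y \<omega>)) * exp (- c * m)"
  by (subst integral_mult_left_zero[symmetric]) (simp add: algebra_simps flip: exp_add)

text \<open>The condition on \<open>c\<close> makes \<open>?q \<le> 1\<close>, as the Bernoulli step
  requires. The linear term \<open>c * expectation Y\<close> is kept and absorbed by
  \<open>1 + x \<le> exp x\<close>, so that it cancels against the centring factor.\<close>

lemma mgf_centered_small: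
  assumes "c\<^sup>2 \<le> 3/2"
  shows "expectation (\<lambda>\<omega>. exp (c * (Y \<omega> - expectation Y))) \<le> exp (2/3 * c\<^sup>2)"
proof -
  let ?q = "2/3 * c\<^sup>2"
  have "exp (c * y) \<le> c * y + (1 + ?q * (exp (y\<^sup>2) - 1))" for y
    using exp_le_add_exp_square[of "c * y"] exp_mult_le_Bernoulli[of ?q "y\<^sup>2"] assms
    by (simp add: power_mult_distrib mult.assoc)
  then have "expectation (\<lambda>\<omega>. exp (c * Y \<omega>)) \<le>
      expectation (\<lambda>\<omega>. c * Y \<omega> + (1 + ?q * (exp ((Y \<omega>)\<^sup>2) - 1)))"
    using integrable_exp_square integrable_exp_mult integrable by (intro integral_mono) auto
  also have "\<dots> = c * expectation Y + (1 + ?q * (expectation (\<lambda>\<omega>. exp ((Y \<omega>)\<^sup>2)) - 1))"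
    using integrable_exp_square integrable by (simp add: prob_space)
  also have "\<dots> \<le> c * expectation Y + (1 + ?q * (2 - 1))"
    using expectation_exp_square_le by (intro add_left_mono mult_left_mono diff_right_mono) auto
  also have "\<dots> = 1 + (c * expectation Y + ?q)" by simp
  also have "\<dots> \<le> exp (c * expectation Y + ?q)"
    by (rule exp_ge_add_one_self)
  finally have "expectation (\<lambda>\<omega>. exp (c * Y \<omega>)) * exp (- c * expectation Y) \<le>
      exp (c * expectation Y + ?q) * exp (- c * expectation Y)"
    by (intro mult_right_mono) auto
  also have "\<dots> = exp ?q" by (simp flip: exp_add)
  finally show ?thesis by (subst expectation_exp_centered)
qed

text \<open>An anchor well below the target \<open>exp (8/3)\<close> at \<open>c = 2\<close>; this
  slack is what lets the interpolation on both sides succeed.\<close>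

lemma mgf_centered_2:
  "expectation (\<lambda>\<omega>. exp (2 * (Y \<omega> - expectation Y))) \<le> exp (1 + ln 2)"
proof -
  have "expectation (\<lambda>\<omega>. exp (2 * Y \<omega>)) \<le> expectation (\<lambda>\<omega>. 4 * Y \<omega> + 2 * exp ((Y \<omega>)\<^sup>2))"
    using integrable_exp_square integrable_exp_mult integrable by (intro integral_mono exp_2_mult_le) auto
  also have "\<dots> = 4 * expectation Y + 2 * expectation (\<lambda>\<omega>. exp ((Y \<omega>)\<^sup>2))"
    using integrable_exp_square integrable by simp
  also have "\<dots> \<le> 2 * (1 + (1 + 2 * expectation Y))"
    using expectation_exp_square_le by simp
  also have "\<dots> \<le> 2 * exp (1 + 2 * expectation Y)"
    by (intro mult_left_mono exp_ge_add_one_self) auto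
  finally have "expectation (\<lambda>\<omega>. exp (2 * Y \<omega>)) * exp (- 2 * expectation Y) \<le>
      2 * exp (1 + 2 * expectation Y) * exp (- 2 * expectation Y)"
    by (intro mult_right_mono) auto
  also have "\<dots> = exp (1 + ln 2)" by (simp add: exp_add exp_minus)
  finally show ?thesis by (subst expectation_exp_centered)
qed

text \<open>For large \<open>c\<close> completing the square costs only
  \<open>c\<^sup>2 / 4\<close>, which leaves room for the crude bound 1 on the absolute
  mean.\<close>

lemma mgf_centered_large:
  assumes c: "3 \<le> c"
  shows "expectation (\<lambda>\<omega>. exp (c * (Y \<omega> - expectation Y))) \<le> exp (2/3 * c\<^sup>2)"
proof -
  have "c * y \<le> c\<^sup>2 / 4 + y\<^sup>2" for y :: real
    using zero_le_power2[of "c / 2 - y"] by (simp add: power2_eq_square algebra_simps)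
  then have "exp (c * y) \<le> exp (c\<^sup>2 / 4) * exp (y\<^sup>2)" for y
    by (simp flip: exp_add)
  then have "expectation (\<lambda>\<omega>. exp (c * Y \<omega>)) \<le> expectation (\<lambda>\<omega>. exp (c\<^sup>2 / 4) * exp ((Y \<omega>)\<^sup>2))"
    using integrable_exp_square integrable_exp_mult by (intro integral_mono) auto
  also have "\<dots> \<le> exp (c\<^sup>2 / 4) * 2"
    using expectation_exp_square_le by simp
  also have "\<dots> = exp (c\<^sup>2 / 4 + ln 2)" by (simp add: exp_add)
  finally have "expectation (\<lambda>\<omega>. exp (c * Y \<omega>)) * exp (- c * expectation Y) \<le>
      exp (c\<^sup>2 / 4 + ln 2) * exp (- c * expectation Y)"
    by (intro mult_right_mono) auto
  also have "\<dots> = exp (c\<^sup>2 / 4 + ln 2 - c * expectation Y)" by (simp flip: exp_add)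
  also have "\<dots> \<le> exp (2/3 * c\<^sup>2)"
  proof -
    have "c * (- expectation Y) \<le> c * 1"
      using abs_expectation_le_1 c by (intro mult_left_mono) auto
    moreover have "3 * c \<le> c\<^sup>2" using c by (simp add: power2_eq_square)
    \<comment> \<open>The remaining \<open>5/12 * c\<^sup>2\<close> is at least
      \<open>5/4 * c\<close>, and \<open>c / 4\<close> is at least 3/4, above
      \<open>ln 2\<close>.\<close>
    ultimately show ?thesis using ln2_le_25_over_36 c by simp
  qed
  finally show ?thesis by (subst expectation_exp_centered)
qed

text \<open>The intermediate exponents are interpolated between the exponents 6/5, 2 and 3 by log-convexity.\<close>

lemma mgf_centered_nonneg:
  assumes "0 \<le> c"
  shows "expectation (\<lambda>\<omega>. exp (c * (Y \<omega> - expectation Y))) \<le> exp (2/3 * c\<^sup>2)"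
proof -
  consider "c \<le> 6/5" | "6/5 \<le> c" "c \<le> 2" | "2 \<le> c" "c \<le> 3" | "3 \<le> c" by linarith
  then show ?thesis
  proof cases
    case 1
    then have "c\<^sup>2 \<le> (6/5)\<^sup>2" using assms by (intro power_mono) auto
    then show ?thesis by (intro mgf_centered_small) (simp add: power2_eq_square)
  next
    case 2
    let ?\<theta> = "(c - 6/5) * (5/4)"
    have c: "(1 - ?\<theta>) * (6/5) + ?\<theta> * 2 = c" by (simp add: field_simps)
    have "expectation (\<lambda>\<omega>. exp (6/5 * (Y \<omega> - expectation Y))) \<le> exp (24/25)"
      using mgf_centered_small[of "6/5"] by (simp add: power_divide)
    then have "expectation (\<lambda>\<omega>. exp (((1 - ?\<theta>) * (6/5) + ?\<theta> * 2) * (Y \<omega> - expectation Y)))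
        \<le> exp ((1 - ?\<theta>) * (24/25) + ?\<theta> * (1 + ln 2))"
      using 2 by (intro mgf_interpolate integrable_exp_centered mgf_centered_2) auto
    also have "\<dots> \<le> exp (2/3 * c\<^sup>2)"
    proof -
      have "?\<theta> * (1 + ln 2) \<le> ?\<theta> * (61/36)"
        using 2 ln2_le_25_over_36 by (intro mult_left_mono) auto
      \<comment> \<open>Tangent of the parabola at 6/5. The interpolating line starts at the same
        value 24/25 as the parabola scaled by 2/3 and has smaller slope than its tangent
        there.\<close>
      moreover have "(12/5) * c - 36/25 \<le> c\<^sup>2"
        using zero_le_power2[of "c - 6/5"] by (simp add: power2_diff power_divide)
      ultimately have "(1 - ?\<theta>) * (24/25) + ?\<theta> * (1 + ln 2) \<le> 2/3 * c\<^sup>2" using 2 by argo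
      then show ?thesis by simp
    qed
    finally show ?thesis unfolding c .
  next
    case 3
    let ?\<theta> = "c - 2"
    have c: "(1 - ?\<theta>) * 2 + ?\<theta> * 3 = c" by (simp add: field_simps)
    have "expectation (\<lambda>\<omega>. exp (((1 - ?\<theta>) * 2 + ?\<theta> * 3) * (Y \<omega> - expectation Y)))
        \<le> exp ((1 - ?\<theta>) * (1 + ln 2) + ?\<theta> * (2/3 * 3\<^sup>2))"
      using 3 by (intro mgf_interpolate integrable_exp_centered mgf_centered_large mgf_centered_2) auto
    also have "\<dots> \<le> exp (2/3 * c\<^sup>2)"
    proof -
      have "(1 - ?\<theta>) * (1 + ln 2) \<le> (1 - ?\<theta>) * (61/36)"
        using 3 ln2_le_25_over_36 by (intro mult_left_mono) auto
      \<comment> \<open>Tangent at 3. Scaled by 2/3 it meets the interpolating line at 3 and has the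
        value 2 at \<open>c = 2\<close>, above 61/36.\<close>
      moreover have "6 * c - 9 \<le> c\<^sup>2"
        using zero_le_power2[of "c - 3"] by (simp add: power2_diff)
      moreover have "0 \<le> (3 - c) * (c - 2)" using 3 by simp
      ultimately show ?thesis using 3 by (simp add: power2_eq_square algebra_simps)
    qed
    finally show ?thesis unfolding c .
  next
    case 4
    then show ?thesis by (rule mgf_centered_large)
  qed
qed

lemma mgf_centered:
  "expectation (\<lambda>\<omega>. exp (c * (Y \<omega> - expectation Y))) \<le> exp (2/3 * c\<^sup>2)"
proof (cases "0 \<le> c")
  case False
  interpret neg: psi2_unit_ball M "\<lambda>\<omega>. - Y \<omega>" by (rule uminus_psi2_unit_ball)
  have "expectation (\<lambda>\<omega>. exp (- c * (- Y \<omega> - expectation (\<lambda>\<omega>. - Y \<omega>)))) \<le> exp (2/3 * (- c)\<^sup>2)"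
    using False by (intro neg.mgf_centered_nonneg) simp
  then show ?thesis by (simp add: algebra_simps)
qed (rule mgf_centered_nonneg)

end

text \<open>The unit-ball results for \<open>X / t\<close>. The last bound is stated as a
  nonnegative integral, the form that the product formula for independent variables takes
  below.\<close>

lemma (in prob_space) psi2_ball_scale:
  fixes X :: "'a \<Rightarrow> real"
  assumes [measurable]: "X \<in> borel_measurable M" and t: "0 < t"
    and le: "(\<integral>\<^sup>+\<omega>. ennreal (exp ((X \<omega>)\<^sup>2 / t\<^sup>2)) \<partial>M) \<le> 2"
  shows "integrable M (\<lambda>\<omega>. (X \<omega>)\<^sup>2)" and "expectation (\<lambda>\<omega>. (X \<omega>)\<^sup>2) \<le> t\<^sup>2"
    and "\<bar>expectation X\<bar> \<le> t"
    and "(\<integral>\<^sup>+\<omega>. ennreal (exp (c * (X \<omega> - expectation X))) \<partial>M) \<le> ennreal (exp (2/3 * c\<^sup>2 * t\<^sup>2))"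
proof -
  interpret psi2_unit_ball M "\<lambda>\<omega>. X \<omega> / t"
    using le by unfold_locales (auto simp: power_divide)
  have eq: "(\<lambda>\<omega>. (X \<omega>)\<^sup>2) = (\<lambda>\<omega>. (X \<omega> / t)\<^sup>2 * t\<^sup>2)" using t by (simp add: power_divide)
  show "integrable M (\<lambda>\<omega>. (X \<omega>)\<^sup>2)"
    unfolding eq by (intro integrable_mult_left integrable_square)
  show "expectation (\<lambda>\<omega>. (X \<omega>)\<^sup>2) \<le> t\<^sup>2"
    unfolding eq using expectation_square_le mult_right_mono[of _ 1 "t\<^sup>2"] by simp
  show "\<bar>expectation X\<bar> \<le> t"
    using abs_expectation_le_1 t by (simp add: field_simps)
  have ct: "c * t * (X \<omega> / t - expectation (\<lambda>\<omega>. X \<omega> / t)) = c * (X \<omega> - expectation X)" for \<omega>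
    using t by (simp add: field_simps)
  have "(\<integral>\<^sup>+\<omega>. ennreal (exp (c * (X \<omega> - expectation X))) \<partial>M)
      = ennreal (expectation (\<lambda>\<omega>. exp (c * (X \<omega> - expectation X))))"
    using integrable_exp_centered[of "c * t"] unfolding ct[symmetric]
    by (intro nn_integral_eq_integral) auto
  also have "\<dots> \<le> ennreal (exp (2/3 * c\<^sup>2 * t\<^sup>2))"
    using mgf_centered[of "c * t"] unfolding ct
    by (intro ennreal_leI) (simp add: power_mult_distrib mult.assoc)
  finally show "(\<integral>\<^sup>+\<omega>. ennreal (exp (c * (X \<omega> - expectation X))) \<partial>M) \<le> ennreal (exp (2/3 * c\<^sup>2 * t\<^sup>2))" .
qed

section \<open>Chernoff bounds for weighted sums of independent variables\<close>

text \<open>Independence factorises the moment generating function, and unit norm of the weights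
  makes the exponents add up to that of a single variable.\<close>

lemma (in prob_space) subgaussian_sum_upper_tail:
  fixes Z :: "'i \<Rightarrow> 'a \<Rightarrow> real"
  assumes I: "finite I" and indep: "indep_vars (\<lambda>_. borel) Z I"
    and mgf: "\<And>i c. i \<in> I \<Longrightarrow> (\<integral>\<^sup>+\<omega>. ennreal (exp (c * Z i \<omega>)) \<partial>M) \<le> ennreal (exp (c\<^sup>2 * v))"
    and w: "(\<Sum>i\<in>I. (w i)\<^sup>2) = 1" and v: "0 < v" and b: "0 < b"
  shows "prob {\<omega> \<in> space M. b \<le> (\<Sum>i\<in>I. w i * Z i \<omega>)} \<le> exp (- (b\<^sup>2 / (4 * v)))"
proof -
  have meas [measurable]: "i \<in> I \<Longrightarrow> Z i \<in> borel_measurable M" for i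
    using indep by (simp add: indep_vars_def2)
  \<comment> \<open>The minimiser of \<open>r\<^sup>2 * v - r * b\<close>.\<close>
  define r where "r = b / (2 * v)"
  have r: "0 < r" using v b by (simp add: r_def)
  let ?A = "{\<omega> \<in> space M. b \<le> (\<Sum>i\<in>I. w i * Z i \<omega>)}"
  have "ennreal (prob ?A) = emeasure M ?A"
    by (simp add: emeasure_eq_measure)
  also have "\<dots> \<le> ennreal (exp (- r * b)) * (\<integral>\<^sup>+\<omega>\<in>space M. ennreal (exp (r * (\<Sum>i\<in>I. w i * Z i \<omega>))) \<partial>M)"
    by (intro Chernoff_ineq_nn_integral_ge r) auto
  also have "(\<integral>\<^sup>+\<omega>\<in>space M. ennreal (exp (r * (\<Sum>i\<in>I. w i * Z i \<omega>))) \<partial>M) =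
      (\<integral>\<^sup>+\<omega>. (\<Prod>i\<in>I. ennreal (exp (r * w i * Z i \<omega>))) \<partial>M)"
    using I by (intro nn_integral_cong)
      (simp add: sum_distrib_left exp_sum prod_ennreal mult.assoc)
  also have "\<dots> = (\<Prod>i\<in>I. \<integral>\<^sup>+\<omega>. ennreal (exp (r * w i * Z i \<omega>)) \<partial>M)"
    by (intro indep_vars_nn_integral I indep_vars_compose2[OF indep]) auto
  also have "\<dots> \<le> (\<Prod>i\<in>I. ennreal (exp ((r * w i)\<^sup>2 * v)))"
    by (intro prod_mono_ennreal mgf)
  also have "\<dots> = ennreal (exp (r\<^sup>2 * v * (\<Sum>i\<in>I. (w i)\<^sup>2)))"
    using I by (simp add: prod_ennreal exp_sum sum_distrib_left power_mult_distrib mult_ac)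
  finally have "ennreal (prob ?A) \<le> ennreal (exp (- r * b)) * ennreal (exp (r\<^sup>2 * v))"
    unfolding w by (simp add: mult_left_mono)
  also have "\<dots> = ennreal (exp (r\<^sup>2 * v - r * b))"
    by (simp add: exp_add[symmetric] flip: ennreal_mult)
  also have "r\<^sup>2 * v - r * b = - (b\<^sup>2 / (4 * v))"
    using v by (simp add: r_def field_simps power2_eq_square)
  finally show ?thesis by simp
qed

lemma (in prob_space) subgaussian_sum_tail:
  fixes Z :: "'i \<Rightarrow> 'a \<Rightarrow> real"
  assumes I: "finite I" and indep: "indep_vars (\<lambda>_. borel) Z I"
    and mgf: "\<And>i c. i \<in> I \<Longrightarrow> (\<integral>\<^sup>+\<omega>. ennreal (exp (c * Z i \<omega>)) \<partial>M) \<le> ennreal (exp (c\<^sup>2 * v))"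
    and w: "(\<Sum>i\<in>I. (w i)\<^sup>2) = 1" and v: "0 < v" and b: "0 < b"
  shows "prob {\<omega> \<in> space M. b \<le> \<bar>\<Sum>i\<in>I. w i * Z i \<omega>\<bar>} \<le> 2 * exp (- (b\<^sup>2 / (4 * v)))"
proof -
  have meas [measurable]: "i \<in> I \<Longrightarrow> Z i \<in> borel_measurable M" for i
    using indep by (simp add: indep_vars_def2)
  let ?A = "\<lambda>w. {\<omega> \<in> space M. b \<le> (\<Sum>i\<in>I. w i * Z i \<omega>)}"
  have "{\<omega> \<in> space M. b \<le> \<bar>\<Sum>i\<in>I. w i * Z i \<omega>\<bar>} = ?A w \<union> ?A (\<lambda>i. - w i)"
    by (auto simp: sum_negf abs_real_def)
  moreover have "prob (?A w \<union> ?A (\<lambda>i. - w i)) \<le> prob (?A w) + prob (?A (\<lambda>i. - w i))"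
    by (intro measure_Un_le) measurable
  moreover have "prob (?A w) \<le> exp (- (b\<^sup>2 / (4 * v)))"
    by (intro subgaussian_sum_upper_tail assms)
  moreover have "prob (?A (\<lambda>i. - w i)) \<le> exp (- (b\<^sup>2 / (4 * v)))"
    using w by (intro subgaussian_sum_upper_tail assms) auto
  ultimately show ?thesis by simp
qed

section \<open>The CUSUM statistic as a linear contrast, and the stopping time\<close>

text \<open>Coefficients of the linear form inside the absolute value of \<open>cusum\<close>. They
  form a unit vector orthogonal to the constants, so the statistic is a normalised contrast of the
  two blocks.\<close>

definition cusum_weight :: "nat \<Rightarrow> nat \<Rightarrow> nat \<Rightarrow> real" where
  "cusum_weight s t l =
     (if l \<le> s then sqrt ((real t - real s) / (real t * real s))
      else - sqrt (real s / (real t * (real t - real s))))"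

lemma sum_atLeastAtMost_split:
  fixes g :: "nat \<Rightarrow> 'a::comm_monoid_add"
  assumes "s < t"
  shows "(\<Sum>l=1..t. g l) = (\<Sum>l=1..s. g l) + (\<Sum>l=s+1..t. g l)"
  using sum.ub_add_nat[of 1 s g "t - s"] assms by simp

lemma cusum_eq_weighted_sum:
  assumes "s < t"
  shows "cusum X s t \<omega> = \<bar>\<Sum>l=1..t. cusum_weight s t l * X l \<omega>\<bar>"
  unfolding cusum_def sum_atLeastAtMost_split[OF assms]
  by (simp add: cusum_weight_def sum_distrib_left sum_negf)

lemma sum_cusum_weight_square:
  assumes "1 \<le> s" "s < t"
  shows "(\<Sum>l=1..t. (cusum_weight s t l)\<^sup>2) = 1"
proof -
  obtain d where d: "t = s + d" "0 < d" using assms(2) less_imp_add_positive by blast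
  have "real s * (real d / ((real s + real d) * real s)) + real d * (real s / ((real s + real d) * real d)) = 1"
  proof -
    have "real s * (real d / ((real s + real d) * real s)) = real d / (real s + real d)"
      "real d * (real s / ((real s + real d) * real d)) = real s / (real s + real d)"
      using assms d by simp_all
    then show ?thesis
      using d by (simp add: add.commute flip: add_divide_distrib)
  qed
  then show ?thesis
    unfolding sum_atLeastAtMost_split[OF assms(2)]
    using d by (simp add: cusum_weight_def)
qed

text \<open>Gives the drift of the statistic that splits at the change point; with
  \<open>p = q\<close> it says that constant means contribute nothing.\<close>

lemma sum_cusum_weight_step:
  assumes "1 \<le> s" "s < t"
    and "\<And>l. 1 \<le> l \<Longrightarrow> l \<le> s \<Longrightarrow> f l = p" and "\<And>l. s < l \<Longrightarrow> l \<le> t \<Longrightarrow> f l = q"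
  shows "(\<Sum>l=1..t. cusum_weight s t l * f l) = sqrt (real s * (real t - real s) / real t) * (p - q)"
proof -
  have sqrt_eq: "x * sqrt (y / (real t * x)) = sqrt (x * y / real t)" if "0 < x" for x y :: real
  proof -
    have "x * sqrt (y / (real t * x)) = sqrt (x\<^sup>2) * sqrt (y / (real t * x))"
      using that by simp
    also have "\<dots> = sqrt (x\<^sup>2 * (y / (real t * x)))" by (rule real_sqrt_mult[symmetric])
    also have "x\<^sup>2 * (y / (real t * x)) = x * y / real t"
      using that by (simp add: power2_eq_square)
    finally show ?thesis .
  qed
  have "real s * sqrt ((real t - real s) / (real t * real s)) = sqrt (real s * (real t - real s) / real t)"
    using assms by (intro sqrt_eq) simp
  moreover have "(real t - real s) * sqrt (real s / (real t * (real t - real s))) = sqrt (real s * (real t - real s) / real t)"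
    using assms sqrt_eq[of "real t - real s" "real s"] by (simp add: mult.commute)
  moreover have "(\<Sum>l=1..t. cusum_weight s t l * f l) =
      (real s * sqrt ((real t - real s) / (real t * real s))) * p
      - ((real t - real s) * sqrt (real s / (real t * (real t - real s)))) * q"
    unfolding sum_atLeastAtMost_split[OF assms(2)]
    using assms by (simp add: cusum_weight_def of_nat_diff)
  ultimately show ?thesis by (simp add: right_diff_distrib)
qed

lemma threshold_square:
  assumes "0 < \<alpha>" "\<alpha> < 1" "1 \<le> t"
  shows "(threshold \<sigma> \<alpha> t)\<^sup>2 = 8 * \<sigma>\<^sup>2 * ln (real t / \<alpha>)"
proof -
  have "(2 powr (3/2 :: real))\<^sup>2 = (2::real) powr 3"
    by (simp add: power2_eq_square flip: powr_add)
  also have "\<dots> = 8" by simp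
  finally show ?thesis
    using assms by (simp add: threshold_def power_mult_distrib)
qed

text \<open>A nonempty set in the well-order \<open>enat\<close> attains its infimum, so stopping by
  a finite time is the same as an actual alarm by then.\<close>

lemma stop_time_le_iff:
  "stop_time \<sigma> \<alpha> X \<omega> \<le> enat n \<longleftrightarrow>
    (\<exists>t. 2 \<le> t \<and> t \<le> n \<and> (\<exists>s\<in>{1..t-1}. cusum X s t \<omega> > threshold \<sigma> \<alpha> t))"
    (is "_ \<longleftrightarrow> (\<exists>t. _ \<and> _ \<and> ?P t)")
proof
  assume le: "stop_time \<sigma> \<alpha> X \<omega> \<le> enat n"
  let ?A = "enat ` {t. 2 \<le> t \<and> ?P t}"
  have "?A \<noteq> {}"
  proof
    assume "?A = {}"
    then have "stop_time \<sigma> \<alpha> X \<omega> = \<infinity>"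
      unfolding stop_time_def by (simp only: Inf_empty top_enat_def)
    then show False using le by simp
  qed
  then obtain k where "k \<in> ?A" by blast
  then have "Inf ?A \<in> ?A" by (rule wellorder_InfI)
  then show "\<exists>t. 2 \<le> t \<and> t \<le> n \<and> ?P t"
    using le unfolding stop_time_def by auto
next
  assume "\<exists>t. 2 \<le> t \<and> t \<le> n \<and> ?P t"
  then obtain t where t: "2 \<le> t" "t \<le> n" "?P t" by blast
  then have "stop_time \<sigma> \<alpha> X \<omega> \<le> enat t"
    unfolding stop_time_def by (intro Inf_lower) blast
  also have "\<dots> \<le> enat n" using t by simp
  finally show "stop_time \<sigma> \<alpha> X \<omega> \<le> enat n" .
qed

section \<open>Independent sequences with bounded psi2 norm\<close>

locale psi2_sequence = prob_space M for M :: "'a measure" +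
  fixes X :: "nat \<Rightarrow> 'a \<Rightarrow> real" and f :: "nat \<Rightarrow> real" and \<sigma> :: real
  assumes indep: "indep_vars (\<lambda>_. borel) X {1..}"
    and mean: "\<And>i. 1 \<le> i \<Longrightarrow> expectation (X i) = f i"
    and norm_le: "(SUP i\<in>{1..}. psi2_norm M (X i)) \<le> ereal \<sigma>"
begin

lemma X_measurable [measurable]: "1 \<le> i \<Longrightarrow> X i \<in> borel_measurable M"
  using indep by (simp add: indep_vars_def2)

text \<open>The norm is an infimum, so \<open>norm_le\<close> yields an admissible scale only below
  each \<open>t\<close> strictly above \<open>\<sigma>\<close>. The bounds at
  \<open>\<sigma>\<close> itself follow by letting \<open>t\<close> decrease.\<close>

lemma psi2_bound_attained:
  assumes "1 \<le> i" "\<sigma> < t"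
  obtains u where "0 < u" "u < t" "(\<integral>\<^sup>+\<omega>. ennreal (exp ((X i \<omega>)\<^sup>2 / u\<^sup>2)) \<partial>M) \<le> 2"
proof -
  have "psi2_norm M (X i) \<le> ereal \<sigma>"
    using norm_le assms(1) by (auto simp: SUP_le_iff)
  also have "\<dots> < ereal t" using assms(2) by simp
  finally show ?thesis
    unfolding psi2_norm_def Inf_less_iff using that by auto
qed

lemma second_moment_le:
  assumes "1 \<le> i" "\<sigma> < t"
  shows "integrable M (\<lambda>\<omega>. (X i \<omega>)\<^sup>2)" "expectation (\<lambda>\<omega>. (X i \<omega>)\<^sup>2) \<le> t\<^sup>2"
proof -
  obtain u where u: "0 < u" "u < t" "(\<integral>\<^sup>+\<omega>. ennreal (exp ((X i \<omega>)\<^sup>2 / u\<^sup>2)) \<partial>M) \<le> 2"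
    using psi2_bound_attained[OF assms] .
  show "integrable M (\<lambda>\<omega>. (X i \<omega>)\<^sup>2)"
    by (rule psi2_ball_scale[OF X_measurable[OF assms(1)] u(1,3)])
  have "u\<^sup>2 \<le> t\<^sup>2" using u by (intro power_mono) auto
  then show "expectation (\<lambda>\<omega>. (X i \<omega>)\<^sup>2) \<le> t\<^sup>2"
    using psi2_ball_scale(2)[OF X_measurable[OF assms(1)] u(1,3)] by simp
qed

lemma abs_mean_le:
  assumes "1 \<le> i"
  shows "\<bar>f i\<bar> \<le> \<sigma>"
proof (rule dense_ge)
  fix t assume "\<sigma> < t"
  with assms obtain u where u: "0 < u" "u < t" "(\<integral>\<^sup>+\<omega>. ennreal (exp ((X i \<omega>)\<^sup>2 / u\<^sup>2)) \<partial>M) \<le> 2"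
    using psi2_bound_attained by blast
  show "\<bar>f i\<bar> \<le> t"
    using psi2_ball_scale(3)[OF X_measurable[OF assms(1)] u(1,3)] u mean[OF assms] by simp
qed

lemma sigma_nonneg: "0 \<le> \<sigma>"
  using abs_mean_le[of 1] by simp

lemma mgf_le:
  assumes i: "1 \<le> i"
  shows "(\<integral>\<^sup>+\<omega>. ennreal (exp (c * (X i \<omega> - f i))) \<partial>M) \<le> ennreal (exp (c\<^sup>2 * (2/3 * \<sigma>\<^sup>2)))"
proof (rule LIMSEQ_le_const)
  show "(\<lambda>n. ennreal (exp (c\<^sup>2 * (2/3 * (\<sigma> + inverse (real (Suc n)))\<^sup>2)))) \<longlonglongrightarrow>
      ennreal (exp (c\<^sup>2 * (2/3 * \<sigma>\<^sup>2)))"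
    using LIMSEQ_inverse_real_of_nat_add[of \<sigma>] by (intro tendsto_intros tendsto_ennrealI) auto
  have "(\<integral>\<^sup>+\<omega>. ennreal (exp (c * (X i \<omega> - f i))) \<partial>M) \<le> ennreal (exp (c\<^sup>2 * (2/3 * t\<^sup>2)))"
    if t: "\<sigma> < t" for t
  proof -
    obtain u where u: "0 < u" "u < t" "(\<integral>\<^sup>+\<omega>. ennreal (exp ((X i \<omega>)\<^sup>2 / u\<^sup>2)) \<partial>M) \<le> 2"
      using psi2_bound_attained[OF i t] .
    have "(\<integral>\<^sup>+\<omega>. ennreal (exp (c * (X i \<omega> - f i))) \<partial>M) \<le> ennreal (exp (2/3 * c\<^sup>2 * u\<^sup>2))"
      using psi2_ball_scale(4)[OF X_measurable[OF i] u(1,3)] mean[OF i] by simp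
    also have "\<dots> \<le> ennreal (exp (c\<^sup>2 * (2/3 * t\<^sup>2)))"
    proof -
      have "u\<^sup>2 \<le> t\<^sup>2" using u by (intro power_mono) auto
      then have "c\<^sup>2 * u\<^sup>2 \<le> c\<^sup>2 * t\<^sup>2" by (intro mult_left_mono) auto
      then show ?thesis by (intro ennreal_leI) simp
    qed
    finally show ?thesis .
  qed
  then show "\<exists>N. \<forall>n\<ge>N. (\<integral>\<^sup>+\<omega>. ennreal (exp (c * (X i \<omega> - f i))) \<partial>M) \<le>
      ennreal (exp (c\<^sup>2 * (2/3 * (\<sigma> + inverse (real (Suc n)))\<^sup>2)))"
    by auto
qed

text \<open>Treats the degenerate scale, where the threshold vanishes and Chernoff's bound, stated
  for positive level and \<open>v\<close>, does not apply.\<close>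

lemma AE_zero_if_sigma_zero:
  assumes "\<sigma> = 0" "1 \<le> i"
  shows "AE \<omega> in M. X i \<omega> = 0"
proof -
  have "expectation (\<lambda>\<omega>. (X i \<omega>)\<^sup>2) \<le> 0"
  proof (rule dense_ge)
    fix e :: real assume "0 < e"
    then show "expectation (\<lambda>\<omega>. (X i \<omega>)\<^sup>2) \<le> e"
      using second_moment_le(2)[OF assms(2), of "sqrt e"] assms(1) by simp
  qed
  moreover have "0 \<le> expectation (\<lambda>\<omega>. (X i \<omega>)\<^sup>2)" by simp
  ultimately have "expectation (\<lambda>\<omega>. (X i \<omega>)\<^sup>2) = 0" by linarith
  then show ?thesis
    using second_moment_le(1)[OF assms(2), of 1] assms(1)
    by (subst (asm) integral_nonneg_eq_0_iff_AE) auto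
qed

section \<open>Centred statistics and the union bound\<close>

definition noise :: "nat \<Rightarrow> nat \<Rightarrow> 'a \<Rightarrow> real" where
  "noise s t \<omega> = (\<Sum>l=1..t. cusum_weight s t l * (X l \<omega> - f l))"

lemma noise_measurable [measurable]: "noise s t \<in> borel_measurable M"
  unfolding noise_def by measurable

lemma cusum_eq_noise:
  assumes "s < t"
  shows "cusum X s t \<omega> = \<bar>noise s t \<omega> + (\<Sum>l=1..t. cusum_weight s t l * f l)\<bar>"
  unfolding cusum_eq_weighted_sum[OF assms] noise_def
  by (simp add: right_diff_distrib sum_subtractf)

lemma cusum_eq_noise_constant:
  assumes "1 \<le> s" "s < t" and "\<And>l. 1 \<le> l \<Longrightarrow> l \<le> t \<Longrightarrow> f l = p"
  shows "cusum X s t \<omega> = \<bar>noise s t \<omega>\<bar>"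
  using sum_cusum_weight_step[of s t f p p] assms by (simp add: cusum_eq_noise)

text \<open>One factor \<open>\<alpha> / t\<close> of the cube pays for the level; the remaining
  decay in \<open>t\<close> pays for the union over all \<open>s\<close> and
  \<open>t\<close>.\<close>

lemma noise_tail:
  assumes \<alpha>: "0 < \<alpha>" "\<alpha> < 1" and s: "1 \<le> s" "s < t"
  shows "prob {\<omega> \<in> space M. threshold \<sigma> \<alpha> t < \<bar>noise s t \<omega>\<bar>} \<le> 2 * (\<alpha> / real t) ^ 3"
proof (cases "\<sigma> = 0")
  case True
  have f0: "f l = 0" if "1 \<le> l" for l
    using abs_mean_le[OF that] True by simp
  have "AE \<omega> in M. \<forall>l\<in>{1..t}. X l \<omega> = 0"
    using AE_zero_if_sigma_zero[OF True] by (intro AE_finite_allI) auto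
  \<comment> \<open>Both sides are 0 here, so strictness of the exceedance matters.\<close>
  then have "AE \<omega> in M. \<not> threshold \<sigma> \<alpha> t < \<bar>noise s t \<omega>\<bar>"
    by eventually_elim (simp add: noise_def threshold_def True f0)
  then have "prob {\<omega> \<in> space M. threshold \<sigma> \<alpha> t < \<bar>noise s t \<omega>\<bar>} = 0"
    by (subst prob_eq_0) auto
  then show ?thesis using \<alpha> by simp
next
  case False
  with sigma_nonneg have \<sigma>: "0 < \<sigma>" by simp
  have "1 < real t / \<alpha>" using \<alpha> s by (simp add: field_simps)
  then have L: "0 < ln (real t / \<alpha>)" by simp
  then have b: "0 < threshold \<sigma> \<alpha> t" using \<sigma> by (simp add: threshold_def)
  have "indep_vars (\<lambda>_. borel) (\<lambda>l \<omega>. X l \<omega> - f l) {1..t}"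
    by (intro indep_vars_compose2[OF indep_vars_subset[OF indep]]) auto
  then have "prob {\<omega> \<in> space M. threshold \<sigma> \<alpha> t \<le> \<bar>\<Sum>l=1..t. cusum_weight s t l * (X l \<omega> - f l)\<bar>}
      \<le> 2 * exp (- ((threshold \<sigma> \<alpha> t)\<^sup>2 / (4 * (2/3 * \<sigma>\<^sup>2))))"
    using \<sigma> b s by (intro subgaussian_sum_tail mgf_le sum_cusum_weight_square) auto
  \<comment> \<open>The constants \<open>8 * \<sigma>\<^sup>2\<close> from the threshold and
    \<open>8/3 * \<sigma>\<^sup>2\<close> from the moment bound have quotient 3.\<close>
  also have "(threshold \<sigma> \<alpha> t)\<^sup>2 / (4 * (2/3 * \<sigma>\<^sup>2)) = 3 * ln (real t / \<alpha>)"
    using \<sigma> \<alpha> s by (subst threshold_square) auto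
  also have "- (3 * ln (real t / \<alpha>)) = of_nat 3 * ln (\<alpha> / real t)"
    using \<alpha> s by (simp add: ln_div)
  also have "exp (of_nat 3 * ln (\<alpha> / real t)) = (\<alpha> / real t) ^ 3"
    using \<alpha> s by (subst exp_of_nat_mult) simp
  finally have le: "prob {\<omega> \<in> space M. threshold \<sigma> \<alpha> t \<le> \<bar>noise s t \<omega>\<bar>} \<le> 2 * (\<alpha> / real t) ^ 3"
    by (simp only: noise_def)
  have "prob {\<omega> \<in> space M. threshold \<sigma> \<alpha> t < \<bar>noise s t \<omega>\<bar>} \<le>
      prob {\<omega> \<in> space M. threshold \<sigma> \<alpha> t \<le> \<bar>noise s t \<omega>\<bar>}"
    by (intro finite_measure_mono) auto
  with le show ?thesis by linarith
qed

text \<open>The single exceptional event for all claims. The shift \<open>t = n + 2\<close> makes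
  the union run over all natural \<open>n\<close>, with \<open>s\<close> from 1 to
  \<open>t - 1\<close>.\<close>

definition noise_exceeds :: "real \<Rightarrow> 'a set" where
  "noise_exceeds \<alpha> =
     (\<Union>n. \<Union>s\<in>{1..n+1}. {\<omega> \<in> space M. threshold \<sigma> \<alpha> (n + 2) < \<bar>noise s (n + 2) \<omega>\<bar>})"

lemma noise_exceeds_sets [measurable]: "noise_exceeds \<alpha> \<in> sets M"
  unfolding noise_exceeds_def by measurable

lemma noise_le_threshold:
  assumes "\<omega> \<in> space M" "\<omega> \<notin> noise_exceeds \<alpha>" "1 \<le> s" "s < t"
  shows "\<bar>noise s t \<omega>\<bar> \<le> threshold \<sigma> \<alpha> t"
proof -
  obtain n where n: "t = n + 2"
    using assms(3,4) le_Suc_ex[of 2 t] by (auto simp: add.commute)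
  show ?thesis
    using assms by (force simp: noise_exceeds_def n not_less)
qed

text \<open>The union bound uses \<open>(t - 1) / t\<^sup>3 \<le> 1 / (t * (t + 1))\<close>, which telescopes.\<close>

lemma prob_noise_exceeds:
  assumes \<alpha>: "0 < \<alpha>" "\<alpha> < 1"
  shows "prob (noise_exceeds \<alpha>) < \<alpha>"
proof -
  let ?A = "\<lambda>s t. {\<omega> \<in> space M. threshold \<sigma> \<alpha> t < \<bar>noise s t \<omega>\<bar>}"
  let ?B = "\<lambda>n. \<Union>s\<in>{1..n+1}. ?A s (n + 2)"
  let ?g = "\<lambda>n. 2 * \<alpha> ^ 3 * (inverse (real (n + 2)) - inverse (real (Suc n + 2)))"
  have le: "prob (?B n) \<le> ?g n" for n
  proof -
    have "prob (?B n) \<le> (\<Sum>s\<in>{1..n+1}. prob (?A s (n + 2)))"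
      by (intro finite_measure_subadditive_finite) auto
    also have "\<dots> \<le> (\<Sum>s\<in>{1..n+1}. 2 * (\<alpha> / real (n + 2)) ^ 3)"
      by (intro sum_mono noise_tail \<alpha>) auto
    also have "\<dots> = 2 * \<alpha> ^ 3 * (real (n + 1) / real (n + 2) ^ 3)"
      by (simp add: power_divide)
    also have "\<dots> \<le> ?g n"
    proof (intro mult_left_mono)
      \<comment> \<open>With \<open>t = n + 2\<close> the left side is
        \<open>t * (t\<^sup>2 - 1)\<close>.\<close>
      have "real (n + 1) * (real (n + 2) * real (n + 3)) \<le> real (n + 2) ^ 3"
        by (simp add: power3_eq_cube algebra_simps)
      then have "real (n + 1) / real (n + 2) ^ 3 \<le> 1 / (real (n + 2) * real (n + 3))"
        by (simp add: divide_le_eq le_divide_eq del: of_nat_add)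
      also have "\<dots> = inverse (real (n + 2)) - inverse (real (Suc n + 2))"
        by (simp add: field_simps)
      finally show "real (n + 1) / real (n + 2) ^ 3 \<le> inverse (real (n + 2)) - inverse (real (Suc n + 2))" .
    qed (use \<alpha> in auto)
    finally show ?thesis .
  qed
  have "(\<lambda>n. inverse (real (n + 2))) \<longlonglongrightarrow> 0"
    using LIMSEQ_ignore_initial_segment[OF lim_inverse_n, of 2] by (simp add: add.commute)
  \<comment> \<open>The telescoping sum is its first term 1/2, which cancels the factor 2 of the
    two-sided tail.\<close>
  from sums_mult[OF telescope_sums'[OF this], of "2 * \<alpha> ^ 3"]
  have sums: "?g sums (\<alpha> ^ 3)" by simp
  have summable: "summable (\<lambda>n. prob (?B n))"
    using le by (intro summable_comparison_test'[OF sums_summable[OF sums]]) auto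
  have "prob (noise_exceeds \<alpha>) \<le> (\<Sum>n. prob (?B n))"
    unfolding noise_exceeds_def using summable by (intro finite_measure_subadditive_countably) auto
  also have "\<dots> \<le> (\<Sum>n. ?g n)"
    by (intro suminf_le le summable sums_summable[OF sums])
  also have "\<dots> = \<alpha> ^ 3" using sums by (rule sums_unique[symmetric])
  also have "\<dots> < \<alpha> ^ 1" using \<alpha> by (intro power_strict_decreasing) auto
  finally show ?thesis by simp
qed

section \<open>False alarms\<close>

text \<open>An alarm at \<open>t\<close> uses only data up to \<open>t\<close>, so equal means up to
  \<open>n\<close> suffice. This serves constant means, with arbitrary \<open>n\<close>, and the
  time before a change, with \<open>n = \<Delta>\<close>.\<close>

lemma stop_time_le_imp_noise_exceeds:
  assumes "\<omega> \<in> space M" "stop_time \<sigma> \<alpha> X \<omega> \<le> enat n" "\<And>l. 1 \<le> l \<Longrightarrow> l \<le> n \<Longrightarrow> f l = p"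
  shows "\<omega> \<in> noise_exceeds \<alpha>"
proof (rule ccontr)
  assume nin: "\<omega> \<notin> noise_exceeds \<alpha>"
  obtain t s where t: "2 \<le> t" "t \<le> n" "s \<in> {1..t-1}" "threshold \<sigma> \<alpha> t < cusum X s t \<omega>"
    using assms(2) unfolding stop_time_le_iff by blast
  then have s: "1 \<le> s" "s < t" by auto
  have "cusum X s t \<omega> = \<bar>noise s t \<omega>\<bar>"
    using t assms(3) by (intro cusum_eq_noise_constant[OF s]) auto
  then show False
    using noise_le_threshold[OF assms(1) nin s] t by simp
qed

lemma prob_stop_time_finite_less:
  assumes \<alpha>: "0 < \<alpha>" "\<alpha> < 1" and "constant_means f"
  shows "prob {\<omega> \<in> space M. stop_time \<sigma> \<alpha> X \<omega> < \<infinity>} < \<alpha>"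
proof -
  have "{\<omega> \<in> space M. stop_time \<sigma> \<alpha> X \<omega> < \<infinity>} \<subseteq> noise_exceeds \<alpha>"
  proof safe
    fix \<omega> assume \<omega>: "\<omega> \<in> space M" "stop_time \<sigma> \<alpha> X \<omega> < \<infinity>"
    then obtain n where "stop_time \<sigma> \<alpha> X \<omega> = enat n" by (auto simp: less_infinityE)
    then show "\<omega> \<in> noise_exceeds \<alpha>"
      using \<omega> assms(3) unfolding constant_means_def
      by (intro stop_time_le_imp_noise_exceeds[of \<omega> \<alpha> n "f 1"]) (simp, simp, blast)
  qed
  then have "prob {\<omega> \<in> space M. stop_time \<sigma> \<alpha> X \<omega> < \<infinity>} \<le> prob (noise_exceeds \<alpha>)"
    by (intro finite_measure_mono) auto
  with prob_noise_exceeds[OF \<alpha>] show ?thesis by linarith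
qed

lemma prob_stop_time_le_change_point_less:
  assumes \<alpha>: "0 < \<alpha>" "\<alpha> < 1" and "change_point f \<Delta>"
  shows "prob {\<omega> \<in> space M. stop_time \<sigma> \<alpha> X \<omega> \<le> enat \<Delta>} < \<alpha>"
proof -
  have "{\<omega> \<in> space M. stop_time \<sigma> \<alpha> X \<omega> \<le> enat \<Delta>} \<subseteq> noise_exceeds \<alpha>"
  proof safe
    fix \<omega> assume \<omega>: "\<omega> \<in> space M" "stop_time \<sigma> \<alpha> X \<omega> \<le> enat \<Delta>"
    have "f l = f 1" if "1 \<le> l" "l \<le> \<Delta>" for l
      using assms(3) that unfolding change_point_def by (meson atLeastAtMost_iff)
    with \<omega> show "\<omega> \<in> noise_exceeds \<alpha>"
      by (rule stop_time_le_imp_noise_exceeds)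
  qed
  then have "prob {\<omega> \<in> space M. stop_time \<sigma> \<alpha> X \<omega> \<le> enat \<Delta>} \<le> prob (noise_exceeds \<alpha>)"
    by (intro finite_measure_mono) auto
  with prob_noise_exceeds[OF \<alpha>] show ?thesis by linarith
qed

lemma stop_time_le_sets [measurable]: "{\<omega> \<in> space M. stop_time \<sigma> \<alpha> X \<omega> \<le> enat n} \<in> sets M"
  unfolding stop_time_le_iff cusum_def by measurable

section \<open>Detection delay\<close>

text \<open>The squared drift at the last time \<open>n\<close> of the window is at least
  \<open>75 * \<sigma>\<^sup>2 * L\<close>, a quarter of the constant 300, whereas the square of
  twice the threshold is at most \<open>64 * \<sigma>\<^sup>2 * L\<close>. The constant 600 keeps
  the window length \<open>y\<close> below \<open>\<Delta> / 2\<close>, so that \<open>n\<close> and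
  \<open>\<Delta>\<close> are comparable.\<close>

lemma detection_signal:
  assumes \<alpha>: "0 < \<alpha>" "\<alpha> < 1" and \<sigma>: "0 < \<sigma>" and \<kappa>: "0 < \<kappa>" "\<kappa> \<le> 2 * \<sigma>" and \<Delta>: "2 \<le> \<Delta>"
    and snr: "600 * ln (real \<Delta> / \<alpha>) \<le> real \<Delta> * \<kappa>\<^sup>2 / \<sigma>\<^sup>2"
    and n: "n = nat \<lfloor>real \<Delta> + 300 * (\<sigma>\<^sup>2 * ln (real \<Delta> / \<alpha>) / \<kappa>\<^sup>2)\<rfloor>"
  shows "\<Delta> < n" and "2 * threshold \<sigma> \<alpha> n < sqrt (real \<Delta> * (real n - real \<Delta>) / real n) * \<kappa>"
proof -
  define L where "L = ln (real \<Delta> / \<alpha>)"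
  define y where "y = 300 * (\<sigma>\<^sup>2 * L / \<kappa>\<^sup>2)"
  \<comment> \<open>Here \<open>2 \<le> \<Delta>\<close> enters: it keeps \<open>L\<close> away from
    0, hence the window long, and lets \<open>L\<close> absorb the \<open>ln 2\<close> that arises
    from \<open>n \<le> 2 * \<Delta>\<close>.\<close>
  have "ln 2 \<le> L" unfolding L_def using \<alpha> \<Delta> by (subst ln_le_cancel_iff) (auto simp: field_simps intro: order_trans[of _ 2])
  then have L: "2/3 \<le> L" using ln2_ge_two_thirds by linarith
  have y\<kappa>: "y * \<kappa>\<^sup>2 = 300 * (\<sigma>\<^sup>2 * L)" using \<kappa> by (simp add: y_def)
  have "\<kappa>\<^sup>2 \<le> (2 * \<sigma>)\<^sup>2" using \<kappa> by (intro power_mono) auto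
  then have "50 * \<kappa>\<^sup>2 \<le> 200 * \<sigma>\<^sup>2" by (simp add: power_mult_distrib)
  also have "\<dots> \<le> 300 * (\<sigma>\<^sup>2 * L)" using mult_left_mono[OF L, of "\<sigma>\<^sup>2"] by (simp add: mult_ac)
  finally have y: "50 \<le> y" using \<kappa> y\<kappa> by (metis mult_le_cancel_right_pos zero_less_power)
  have "600 * (\<sigma>\<^sup>2 * L) \<le> real \<Delta> * \<kappa>\<^sup>2" using snr \<sigma> by (simp add: L_def field_simps)
  then have "(2 * y) * \<kappa>\<^sup>2 \<le> real \<Delta> * \<kappa>\<^sup>2" using y\<kappa> by simp
  then have y\<Delta>: "2 * y \<le> real \<Delta>" using \<kappa> by (metis mult_le_cancel_right_pos zero_less_power)
  define h where "h = real n - real \<Delta>"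
  have "real n = of_int \<lfloor>real \<Delta> + y\<rfloor>"
    using y unfolding n y_def L_def by simp
  then have h: "y - 1 < h" "h \<le> y" unfolding h_def by linarith+
  have h2: "y / 2 \<le> h" "0 < h" using h y by auto
  then show "\<Delta> < n" unfolding h_def by simp
  then have n0: "0 < real n" by simp
  have "ln (real n / \<alpha>) \<le> ln (2 * (real \<Delta> / \<alpha>))"
    using \<alpha> n0 h y\<Delta> y unfolding h_def by (subst ln_le_cancel_iff) (auto simp: field_simps)
  also have "\<dots> = ln 2 + L" unfolding L_def using \<alpha> \<Delta> by (intro ln_mult_pos) auto
  also have "\<dots> \<le> 2 * L" using \<open>ln 2 \<le> L\<close> by simp
  finally have ln: "ln (real n / \<alpha>) \<le> 2 * L" .
  have "(2 * threshold \<sigma> \<alpha> n)\<^sup>2 = 32 * \<sigma>\<^sup>2 * ln (real n / \<alpha>)"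
    using \<alpha> n0 by (simp add: power_mult_distrib threshold_square)
  also have "\<dots> \<le> 64 * (\<sigma>\<^sup>2 * L)" using mult_left_mono[OF ln, of "\<sigma>\<^sup>2"] by (simp add: mult_ac)
  also have "\<dots> < 75 * (\<sigma>\<^sup>2 * L)" using \<sigma> L by simp
  also have "\<dots> = y * \<kappa>\<^sup>2 / 4" using y\<kappa> by simp
  also have "\<dots> \<le> h * \<kappa>\<^sup>2 / 2" using mult_right_mono[OF h2(1), of "\<kappa>\<^sup>2"] by simp
  also have "\<dots> \<le> real \<Delta> * h / real n * \<kappa>\<^sup>2"
  proof -
    have "real n \<le> 2 * real \<Delta>" using h y\<Delta> y unfolding h_def by linarith
    then have "h * real n \<le> h * (2 * real \<Delta>)" using h2 by (intro mult_left_mono) auto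
    then have "h / 2 \<le> real \<Delta> * h / real n" using n0 by (simp add: field_simps)
    then have "h / 2 * \<kappa>\<^sup>2 \<le> real \<Delta> * h / real n * \<kappa>\<^sup>2" by (intro mult_right_mono) auto
    then show ?thesis by simp
  qed
  also have "\<dots> = (sqrt (real \<Delta> * h / real n) * \<kappa>)\<^sup>2"
    using h2 by (simp add: power_mult_distrib)
  finally show "2 * threshold \<sigma> \<alpha> n < sqrt (real \<Delta> * (real n - real \<Delta>) / real n) * \<kappa>"
    unfolding h_def[symmetric] using \<kappa> h2 by (elim power_less_imp_less_base) auto
qed

lemma prob_detection_ge:
  assumes \<alpha>: "0 < \<alpha>" "\<alpha> < 1" and cp: "change_point f \<Delta>" and \<Delta>: "2 \<le> \<Delta>"
    and \<kappa>: "\<kappa> = \<bar>f \<Delta> - f (\<Delta> + 1)\<bar>"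
    and snr: "real \<Delta> * \<kappa>\<^sup>2 / \<sigma>\<^sup>2 \<ge> 600 * ln (real \<Delta> / \<alpha>)"
  shows "prob {\<omega> \<in> space M. enat \<Delta> < stop_time \<sigma> \<alpha> X \<omega> \<and>
      ereal_of_enat (stop_time \<sigma> \<alpha> X \<omega>)
        \<le> ereal (real \<Delta> + 300 * (\<sigma>\<^sup>2 * ln (real \<Delta> / \<alpha>) / \<kappa>\<^sup>2))} \<ge> 1 - \<alpha>"
    (is "prob ?E \<ge> _")
proof -
  let ?y = "real \<Delta> + 300 * (\<sigma>\<^sup>2 * ln (real \<Delta> / \<alpha>) / \<kappa>\<^sup>2)"
  define n where "n = nat \<lfloor>?y\<rfloor>"
  have pre: "f l = f 1" if "1 \<le> l" "l \<le> \<Delta>" for l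
    using cp that unfolding change_point_def by (meson atLeastAtMost_iff)
  have post: "f l = f (\<Delta> + 1)" if "\<Delta> < l" for l
  proof -
    have "\<Delta> + 1 \<le> l" using that by simp
    then show ?thesis using cp unfolding change_point_def by blast
  qed
  have "f \<Delta> \<noteq> f (\<Delta> + 1)" using cp unfolding change_point_def by blast
  then have \<kappa>0: "0 < \<kappa>" unfolding \<kappa> by simp
  \<comment> \<open>Both means are bounded by \<open>\<sigma>\<close>. In particular a change forces
    \<open>\<sigma>\<close> to be positive, so the division by \<open>\<sigma>\<^sup>2\<close> is a
    genuine one.\<close>
  have \<kappa>2: "\<kappa> \<le> 2 * \<sigma>" using abs_mean_le[of \<Delta>] abs_mean_le[of "\<Delta> + 1"] \<Delta> by (simp add: \<kappa>)
  have \<sigma>: "0 < \<sigma>" using \<kappa>0 \<kappa>2 by simp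
  note sig = detection_signal[OF \<alpha> \<sigma> \<kappa>0 \<kappa>2 \<Delta> snr n_def]
  have "1 \<le> real \<Delta> / \<alpha>" using \<alpha> \<Delta> by (simp add: field_simps)
  then have y0: "0 \<le> ?y" by simp
  \<comment> \<open>Times are integers or infinite, so the real end of the window can be replaced by
    its floor.\<close>
  have le_y: "ereal_of_enat \<tau> \<le> ereal ?y \<longleftrightarrow> \<tau> \<le> enat n" for \<tau>
  proof (cases \<tau>)
    case (enat k)
    have "k \<le> nat \<lfloor>y\<rfloor> \<longleftrightarrow> real k \<le> y" if "0 \<le> y" for y
      using that by (simp add: le_nat_iff le_floor_iff)
    from this[OF y0] show ?thesis unfolding n_def enat by simp
  qed simp
  have E: "?E = {\<omega> \<in> space M. stop_time \<sigma> \<alpha> X \<omega> \<le> enat n} - {\<omega> \<in> space M. stop_time \<sigma> \<alpha> X \<omega> \<le> enat \<Delta>}"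
    unfolding le_y by (auto simp: not_le)
  have meas: "?E \<in> sets M" unfolding E by measurable
  have "space M - noise_exceeds \<alpha> \<subseteq> ?E"
  proof
    fix \<omega> assume "\<omega> \<in> space M - noise_exceeds \<alpha>"
    then have \<omega>: "\<omega> \<in> space M" "\<omega> \<notin> noise_exceeds \<alpha>" by auto
    have "\<not> stop_time \<sigma> \<alpha> X \<omega> \<le> enat \<Delta>"
      using \<omega> pre stop_time_le_imp_noise_exceeds by blast
    moreover have "stop_time \<sigma> \<alpha> X \<omega> \<le> enat n"
    proof -
      let ?S = "\<Sum>l=1..n. cusum_weight \<Delta> n l * f l"
      have "?S = sqrt (real \<Delta> * (real n - real \<Delta>) / real n) * (f \<Delta> - f (\<Delta> + 1))"
      proof (rule sum_cusum_weight_step)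
        show "f l = f \<Delta>" if "1 \<le> l" "l \<le> \<Delta>" for l
          using pre[OF that] pre[of \<Delta>] \<Delta> by simp
        show "f l = f (\<Delta> + 1)" if "\<Delta> < l" for l
          using that by (rule post)
      qed (use \<Delta> sig(1) in auto)
      then have "\<bar>?S\<bar> = sqrt (real \<Delta> * (real n - real \<Delta>) / real n) * \<kappa>"
        using sig(1) by (simp add: \<kappa> abs_mult)
      then have "2 * threshold \<sigma> \<alpha> n < \<bar>?S\<bar>" using sig(2) by simp
      moreover have "\<bar>noise \<Delta> n \<omega>\<bar> \<le> threshold \<sigma> \<alpha> n"
        using \<Delta> sig(1) by (intro noise_le_threshold[OF \<omega>]) auto
      \<comment> \<open>Reverse triangle inequality: the drift exceeds two thresholds and the noise
        removes at most one.\<close>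
      ultimately have "threshold \<sigma> \<alpha> n < cusum X \<Delta> n \<omega>"
        unfolding cusum_eq_noise[OF sig(1)] by linarith
      then show ?thesis
        unfolding stop_time_le_iff using \<Delta> sig(1) by (intro exI[of _ n]) auto
    qed
    ultimately show "\<omega> \<in> ?E" unfolding E using \<omega> by auto
  qed
  then have "prob (space M - noise_exceeds \<alpha>) \<le> prob ?E"
    using meas by (intro finite_measure_mono)
  moreover have "prob (space M - noise_exceeds \<alpha>) = 1 - prob (noise_exceeds \<alpha>)"
    by (intro prob_compl) measurable
  ultimately show ?thesis using prob_noise_exceeds[OF \<alpha>] by linarith
qed

end
text \<open>For \<open>\<Delta> = 1\<close> any constants with \<open>C_d < C_SNR\<close> would make
  the window of the third claim shorter than 1 under the signal-to-noise condition; it would hold no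
  integer after \<open>\<Delta>\<close>. That claim is therefore made for
  \<open>2 \<le> \<Delta>\<close>.\<close>

theorem theorem1:
  shows "\<exists>C_SNR C_d :: real. 0 < C_SNR \<and> 0 < C_d \<and> C_d < C_SNR \<and>
    (\<forall>(M :: sample measure) (X :: nat \<Rightarrow> sample \<Rightarrow> real) (f :: nat \<Rightarrow> real) (\<sigma> :: real) (\<alpha> :: real).
       prob_space M \<longrightarrow>
       prob_space.indep_vars M (\<lambda>_. borel) X {1..} \<longrightarrow>
       (\<forall>i\<ge>1. prob_space.expectation M (X i) = f i) \<longrightarrow>
       (SUP i\<in>{1..}. psi2_norm M (X i)) \<le> ereal \<sigma> \<longrightarrow>
       0 < \<alpha> \<longrightarrow> \<alpha> < 1 \<longrightarrow>
         (constant_means f \<longrightarrow>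
            measure M {\<omega> \<in> space M. stop_time \<sigma> \<alpha> X \<omega> < \<infinity>} < \<alpha>)
       \<and> (\<forall>\<Delta>. change_point f \<Delta> \<longrightarrow>
            measure M {\<omega> \<in> space M. stop_time \<sigma> \<alpha> X \<omega> \<le> enat \<Delta>} < \<alpha>)
       \<and> (\<forall>\<Delta> \<kappa>. change_point f \<Delta> \<longrightarrow> 2 \<le> \<Delta> \<longrightarrow> \<kappa> = \<bar>f \<Delta> - f (\<Delta> + 1)\<bar> \<longrightarrow>
            real \<Delta> * \<kappa>\<^sup>2 / \<sigma>\<^sup>2 \<ge> C_SNR * ln (real \<Delta> / \<alpha>) \<longrightarrow>
            measure M {\<omega> \<in> space M. enat \<Delta> < stop_time \<sigma> \<alpha> X \<omega> \<and>
              ereal_of_enat (stop_time \<sigma> \<alpha> X \<omega>)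
                \<le> ereal (real \<Delta> + C_d * (\<sigma>\<^sup>2 * ln (real \<Delta> / \<alpha>) / \<kappa>\<^sup>2))} \<ge> 1 - \<alpha>))"
proof (rule exI[of _ "600 :: real"], rule exI[of _ "300 :: real"], intro conjI allI impI)
  fix M :: "sample measure" and X :: "nat \<Rightarrow> sample \<Rightarrow> real" and f :: "nat \<Rightarrow> real"
    and \<sigma> \<alpha> :: real
  assume M: "prob_space M" "prob_space.indep_vars M (\<lambda>_. borel) X {1..}"
    "\<forall>i\<ge>1. prob_space.expectation M (X i) = f i"
    "(SUP i\<in>{1..}. psi2_norm M (X i)) \<le> ereal \<sigma>"
    and \<alpha>: "0 < \<alpha>" "\<alpha> < 1"
  interpret prob_space M by fact
  interpret psi2_sequence M X f \<sigma>
    using M by unfold_locales auto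
  show "measure M {\<omega> \<in> space M. stop_time \<sigma> \<alpha> X \<omega> < \<infinity>} < \<alpha>" if "constant_means f"
    using prob_stop_time_finite_less[OF \<alpha> that] .
  show "measure M {\<omega> \<in> space M. stop_time \<sigma> \<alpha> X \<omega> \<le> enat \<Delta>} < \<alpha>" if "change_point f \<Delta>" for \<Delta>
    using prob_stop_time_le_change_point_less[OF \<alpha> that] .
  show "measure M {\<omega> \<in> space M. enat \<Delta> < stop_time \<sigma> \<alpha> X \<omega> \<and>
      ereal_of_enat (stop_time \<sigma> \<alpha> X \<omega>)
        \<le> ereal (real \<Delta> + 300 * (\<sigma>\<^sup>2 * ln (real \<Delta> / \<alpha>) / \<kappa>\<^sup>2))} \<ge> 1 - \<alpha>"
    if "change_point f \<Delta>" "2 \<le> \<Delta>" "\<kappa> = \<bar>f \<Delta> - f (\<Delta> + 1)\<bar>"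
      "real \<Delta> * \<kappa>\<^sup>2 / \<sigma>\<^sup>2 \<ge> 600 * ln (real \<Delta> / \<alpha>)" for \<Delta> \<kappa>
    using prob_detection_ge[OF \<alpha> that] .
qed auto

end
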